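(* Let $f:\mathbb{R}^d\to\mathbb{R}\cup\{\infty\}$ be $\ell$-smooth and convex, attaining its minimum at a (not necessarily unique) point $x_*\in\mathbb{R}^d$. Let $x_0\in\mathcal{X}$ and let $\{x_k\}_{k\ge0}$ be generated by $$x_{k+1}=x_k-\gamma_k\nabla f(x_k),\qquad \gamma_k=\int_0^1\frac{dv}{\ell(\|\nabla f(x_k)\|+\|\nabla f(x_k)\|v)}.$$ For $M>0$ let $\bar T(M)$ be the number of iterations required to obtain a gradient of norm at most $M$, i.e. the smallest integer $k\ge0$ with $\|\nabla f(x_k)\|\le M$. Then for every $\varepsilon>0$ and every integer $T\ge0$ with $$T\ge\inf_{M>0}\left[\bar T(M)+\frac{\ell(2M)\|x_0-x_*\|^2}{2\varepsilon}\right]$$ one has $f(x_T)-f(x_* )\le\varepsilon$.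
   Context: Norms are Euclidean for vectors and spectral for matrices. For $f:\mathbb{R}^d\to\mathbb{R}\cup\{\infty\}$ put $\mathcal{X}=\{x\in\mathbb{R}^d: f(x)<\infty\}$, assumed to be open and convex. $f$ is $\ell$-smooth if $f$ is twice differentiable on $\mathcal{X}$, $f$ is continuous on the closure of $\mathcal{X}$ (as a map into $\mathbb{R}\cup\{\infty\}$), and $\ell:[0,\infty)\to(0,\infty)$ is a non-decreasing positive locally Lipschitz function such that $\|\nabla^2f(x)\|\le\ell(\|\nabla f(x)\|)$ for all $x\in\mathcal{X}$. (The iteration is well defined: the iterates stay in $\mathcal{X}$.) If no such $k$ exists for some $M$, $\bar T(M)$ is read as $+\infty$. *)

theory Defs
  imports "HOL-Analysis.Analysis"
begin

definition eff_dom :: "('a \<Rightarrow> ereal) \<Rightarrow> 'a set" where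
  "eff_dom f = {x. f x < \<infinity>}"

text \<open>The gradient and the Hessian below are those of the real-valued function obtained from
  \<open>f\<close> by \<^const>\<open>real_of_ereal\<close>. They are meaningful only at points of \<^const>\<open>eff_dom\<close>, which is
  open wherever they are used, so that the value of \<^const>\<open>real_of_ereal\<close> at \<open>\<infinity>\<close> plays no role.\<close>

definition grad :: "(real ^ 'n \<Rightarrow> ereal) \<Rightarrow> real ^ 'n \<Rightarrow> real ^ 'n" where
  "grad f x = (THE D. GDERIV (\<lambda>y. real_of_ereal (f y)) x :> D)"

definition hessian :: "(real ^ 'n \<Rightarrow> ereal) \<Rightarrow> real ^ 'n \<Rightarrow> real ^ 'n ^ 'n" where
  "hessian f x = matrix (frechet_derivative (grad f) (at x))"

definition twice_differentiable_on :: "(real ^ 'n \<Rightarrow> ereal) \<Rightarrow> (real ^ 'n) set \<Rightarrow> bool" where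
  "twice_differentiable_on f X \<longleftrightarrow>
     (\<forall>x\<in>X. (\<lambda>y. real_of_ereal (f y)) differentiable (at x)) \<and>
     (\<forall>x\<in>X. grad f differentiable (at x))"

definition spectral_norm :: "real ^ 'n ^ 'm \<Rightarrow> real" where
  "spectral_norm A = onorm (\<lambda>v. A *v v)"

text \<open>The function \<open>l\<close> of the notion of \<open>l\<close>-smoothness lives on \<open>[0,\<infinity>)\<close>; its values at negative
  arguments are irrelevant. The first parameter of \<^const>\<open>local_lipschitz\<close> is a dummy time
  variable on which \<open>l\<close> does not depend.\<close>

definition ell_smooth :: "(real \<Rightarrow> real) \<Rightarrow> (real ^ 'n \<Rightarrow> ereal) \<Rightarrow> bool" where
  "ell_smooth l f \<longleftrightarrow>
     (\<forall>x. f x \<noteq> -\<infinity>) \<and>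
     open (eff_dom f) \<and> convex (eff_dom f) \<and>
     twice_differentiable_on f (eff_dom f) \<and>
     continuous_on (closure (eff_dom f)) f \<and>
     (\<forall>s\<ge>0. l s > 0) \<and> mono_on {0..} l \<and>
     local_lipschitz (UNIV :: real set) {0..} (\<lambda>_. l) \<and>
     (\<forall>x\<in>eff_dom f. spectral_norm (hessian f x) \<le> l (norm (grad f x)))"

definition convex_ereal :: "(real ^ 'n \<Rightarrow> ereal) \<Rightarrow> bool" where
  "convex_ereal f \<longleftrightarrow>
     (\<forall>x y. \<forall>t\<in>{0..1::real}.
        f ((1 - t) *\<^sub>R x + t *\<^sub>R y) \<le> ereal (1 - t) * f x + ereal t * f y)"

definition step_size :: "(real \<Rightarrow> real) \<Rightarrow> (real ^ 'n \<Rightarrow> ereal) \<Rightarrow> real ^ 'n \<Rightarrow> real" where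
  "step_size l f y =
     integral {0..1} (\<lambda>v. 1 / l (norm (grad f y) + norm (grad f y) * v))"

text \<open>The infimum of the empty set in \<^typ>\<open>enat\<close> is \<open>\<infinity>\<close>, so this is \<open>\<infinity>\<close> if the gradient norm
  never drops to \<open>M\<close>, and the least such index otherwise.\<close>

definition iters_to_grad :: "(real ^ 'n \<Rightarrow> ereal) \<Rightarrow> (nat \<Rightarrow> real ^ 'n) \<Rightarrow> real \<Rightarrow> enat" where
  "iters_to_grad f x M = Inf {enat k | k. norm (grad f (x k)) \<le> M}"

end

theory Submission
  imports Defs
begin

text \<open>Let \<open>x'\<close> be the successor of a point \<open>x\<close> with gradient \<open>g x\<close> of norm \<open>a > 0\<close> and
  step size \<open>\<gamma>\<close>. Three properties of one
  step give the theorem: the step stays in the domain and decreases \<open>f\<close> by at least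
  \<open>\<gamma> * a\<^sup>2 / 2\<close> (\<open>gd_step_in_domain\<close>, \<open>descent\<close>), the gradient norm does not increase
  (\<open>gradient_norm_antimono\<close>), and \<open>\<gamma> \<ge> 1 / l (2 * M)\<close> once the gradient norm is at most \<open>M\<close>
  (\<open>step_length_ge\<close>). The descent inequality and convexity yield
  \<open>(norm (x' - z))\<^sup>2 \<le> (norm (x - z))\<^sup>2 - 2 * \<gamma> * (f x' - f z)\<close> for every \<open>z\<close> in the domain. Summing this from
  the first iteration \<open>k\<close> with gradient norm at most \<open>M\<close> up to iteration \<open>T\<close>, with \<open>z\<close> the minimizer, gives
  \<open>2 * (T - k) * (f (x T) - f z) \<le> l (2 * M) * (norm (x 0 - z))\<^sup>2\<close>
  (\<open>suboptimality_after_small_gradient\<close>), which is the claim for a fixed \<open>M\<close>. A limit handles the infimum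
  over \<open>M\<close>.

  The properties of one step rest on one device. The segment from \<open>x\<close> to \<open>x'\<close> is run through with
  speed \<open>1 / l (a + s)\<close> at time \<open>s\<close>, and the step size is exactly the one for which this takes the time \<open>a\<close>.
  As the Hessian has norm at most \<open>l\<close> of the gradient norm, a comparison argument shows that the
  gradient at time \<open>s\<close> differs from \<open>g x\<close> by at most \<open>s\<close> (\<open>gradient_change_along_arc\<close>). In particular its
  norm is at most \<open>a + s\<close>, and the Hessian at time \<open>s\<close> has norm at most \<open>l (a + s)\<close>, the reciprocal of the
  speed. Consequently \<open>f\<close> decreases along the way, so that the segment cannot leave the domain, and
  the decrease adds up to the one claimed. For the gradient norm, symmetry and positivity of the Hessian
  \<open>H\<close> give \<open>(norm (H v))\<^sup>2 \<le> l (a + s) * (v \<bullet> H v)\<close>, and the factor cancels against the speed on integration,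
  whence \<open>(norm (g x' - g x))\<^sup>2 \<le> g x \<bullet> (g x - g x')\<close>.

  The Hessian is merely a pointwise derivative of the gradient, possibly not integrable along the segment, so all
  these integrations are carried out with mean value theorems.\<close>

section \<open>Calculus of one real variable\<close>

definition reciprocal_primitive :: "(real \<Rightarrow> real) \<Rightarrow> real \<Rightarrow> real" where
  "reciprocal_primitive k s = integral {0..s} (\<lambda>v. 1 / k v)"

lemma
  fixes k :: "real \<Rightarrow> real"
  assumes cont: "continuous_on {0..} k" and pos: "\<And>s. s \<ge> 0 \<Longrightarrow> k s > 0"
  shows continuous_on_reciprocal_primitive: "continuous_on {0..} (reciprocal_primitive k)"
    and DERIV_reciprocal_primitive: "s > 0 \<Longrightarrow> DERIV (reciprocal_primitive k) s :> 1 / k s"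
proof -
  let ?Q = "reciprocal_primitive k"
  have within: "(?Q has_real_derivative 1 / k t) (at t within {0..b})" if "t \<in> {0..b}" for t b
  proof -
    have "continuous_on {0..b} (\<lambda>v. 1 / k v)"
      using pos by (intro continuous_intros continuous_on_subset[OF cont]) force+
    from integral_has_real_derivative[OF this that] show ?thesis
      unfolding reciprocal_primitive_def .
  qed
  show D: "DERIV ?Q s :> 1 / k s" if "s > 0" for s
  proof -
    have "at s within {0..s + 1} = at s"
      by (rule at_within_interior) (use that in simp)
    moreover have "(?Q has_real_derivative 1 / k s) (at s within {0..s + 1})"
      by (rule within) (use that in simp)
    ultimately show ?thesis by simp
  qed
  show "continuous_on {0..} ?Q"
    unfolding continuous_on_eq_continuous_within
  proof
    fix t :: real assume "t \<in> {0..}"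
    then have t: "t \<ge> 0" by simp
    show "continuous (at t within {0..}) ?Q"
    proof (cases "t = 0")
      case False
      then have "isCont ?Q t" using D[of t] t DERIV_isCont by force
      then show ?thesis by (rule continuous_at_imp_continuous_at_within)
    next
      case True
      have "(?Q has_real_derivative 1 / k 0) (at 0 within {0..1})"
        by (rule within) simp
      then have "continuous (at 0 within {0..1}) ?Q"
        by (rule DERIV_continuous)
      moreover have "at (0::real) within {0..} = at 0 within {0..1}"
        by (rule at_within_nhd[of _ "{..<1}"]) auto
      ultimately show ?thesis using True by simp
    qed
  qed
qed

lemma
  fixes k :: "real \<Rightarrow> real"
  assumes cont: "continuous_on {0..} k" and pos: "\<And>s. s \<ge> 0 \<Longrightarrow> k s > 0"
    and mono: "mono_on {0..} k"
    and st: "0 \<le> s" "s \<le> t"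
  shows reciprocal_primitive_diff_ge: "(t - s) / k t \<le> reciprocal_primitive k t - reciprocal_primitive k s"
    and reciprocal_primitive_diff_le: "reciprocal_primitive k t - reciprocal_primitive k s \<le> (t - s) / k s"
proof -
  define Q where "Q = reciprocal_primitive k"
  have "(t - s) / k t \<le> Q t - Q s \<and> Q t - Q s \<le> (t - s) / k s"
  proof (cases "s = t")
    case False
    then have less: "s < t" using st by simp
    have "continuous_on {s..t} Q"
      unfolding Q_def
      by (rule continuous_on_subset[OF continuous_on_reciprocal_primitive[OF cont pos]]) (use st in auto)
    moreover have D: "DERIV Q z :> 1 / k z" if "s < z" for z
      unfolding Q_def by (rule DERIV_reciprocal_primitive[OF cont pos]) (use that st in auto)
    ultimately obtain z where z: "s < z" "z < t" "Q t - Q s = (t - s) * (1 / k z)"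
      using MVT[of s t Q] less by (metis DERIV_unique real_differentiable_def)
    have "k s \<le> k z" "k z \<le> k t"
      using z st by (auto intro!: mono_onD[OF mono])
    moreover have "0 < k s" "0 < k z"
      using z st pos[of s] pos[of z] by auto
    ultimately show ?thesis
      unfolding z(3) using less by (simp add: frac_le)
  qed simp
  then show "(t - s) / k t \<le> reciprocal_primitive k t - reciprocal_primitive k s"
    "reciprocal_primitive k t - reciprocal_primitive k s \<le> (t - s) / k s"
    by (auto simp: Q_def)
qed

text \<open>The comparison principle for \<open>u' \<le> k u / k s\<close>, \<open>u 0 = 0\<close>, whose maximal solution is \<open>u s = s\<close>:
  with the primitive \<open>Q\<close> of \<open>1 / k\<close>, the hypothesis says that \<open>Q (norm (W s)) - Q s\<close> has a nonpositive
  derivative. The norm is not differentiable at zero, so the proof uses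
  \<open>sqrt (\<eta>\<^sup>2 + (norm (W s))\<^sup>2)\<close> in its place and loses \<open>Q \<eta>\<close>, which is arbitrarily small.\<close>

lemma norm_le_of_reciprocal_speed:
  fixes W :: "real \<Rightarrow> 'a::real_inner" and k :: "real \<Rightarrow> real"
  assumes contk: "continuous_on {0..} k" and pos: "\<And>s. s \<ge> 0 \<Longrightarrow> k s > 0"
    and mono: "mono_on {0..} k"
    and b: "b \<ge> 0" and W0: "W 0 = 0" and contW: "continuous_on {0..b} W"
    and deriv: "\<And>s. 0 < s \<Longrightarrow> s < b \<Longrightarrow> (W has_vector_derivative W' s) (at s)"
    and speed: "\<And>s. 0 < s \<Longrightarrow> s < b \<Longrightarrow> norm (W' s) \<le> k (norm (W s)) / k s"
  shows "norm (W b) \<le> b"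
proof (rule ccontr)
  define Q where "Q = reciprocal_primitive k"
  have Qcont: "continuous_on {0..} Q"
    unfolding Q_def by (rule continuous_on_reciprocal_primitive[OF contk]) (rule pos)
  have QD: "DERIV Q s :> 1 / k s" if "s > 0" for s
    unfolding Q_def by (rule DERIV_reciprocal_primitive[OF contk _ that]) (rule pos)
  have Qdiff: "(t - s) / k t \<le> Q t - Q s" "Q t - Q s \<le> (t - s) / k s" if "0 \<le> s" "s \<le> t" for s t
    unfolding Q_def
    by (rule reciprocal_primitive_diff_ge[OF contk _ mono that], erule pos,
        rule reciprocal_primitive_diff_le[OF contk _ mono that], erule pos)
  have Q0: "Q 0 = 0" by (simp add: Q_def reciprocal_primitive_def)
  assume "\<not> norm (W b) \<le> b"
  then have gt: "b < norm (W b)" by simp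
  have "0 < (norm (W b) - b) / k (norm (W b))"
    using gt pos[of "norm (W b)"] by simp
  also have "\<dots> \<le> Q (norm (W b)) - Q b"
    using Qdiff(1)[of b "norm (W b)"] gt b by simp
  finally have gap: "0 < Q (norm (W b)) - Q b" .
  \<comment> \<open>Small enough for \<open>Q \<eta> \<le> \<eta> / k 0\<close> to be half of the gap.\<close>
  define \<eta> where "\<eta> = k 0 * (Q (norm (W b)) - Q b) / 2"
  have \<eta>: "\<eta> > 0" using gap pos[of 0] by (simp add: \<eta>_def)
  define u where "u = (\<lambda>s. sqrt (\<eta>\<^sup>2 + W s \<bullet> W s))"
  have inner0: "\<eta>\<^sup>2 + W s \<bullet> W s > 0" for s
    using \<eta> by (simp add: add_pos_nonneg)
  have upos: "u s > 0" for s using inner0 by (simp add: u_def)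
  have uW: "norm (W s) \<le> u s" for s
    unfolding u_def norm_eq_sqrt_inner by simp
  have contu: "continuous_on {0..b} u"
    unfolding u_def by (intro continuous_intros contW)
  have "Q (u b) - Q b \<le> Q (u 0) - Q 0"
  proof (rule DERIV_nonpos_imp_decreasing_open[OF b])
    show "continuous_on {0..b} (\<lambda>s. Q (u s) - Q s)"
      using b upos
      by (intro continuous_intros continuous_on_compose2[OF Qcont contu]
            continuous_on_subset[OF Qcont]) (auto intro: less_imp_le)
  next
    fix s assume s: "0 < s" "s < b"
    have "((\<lambda>t. W t \<bullet> W t) has_real_derivative 2 * (W s \<bullet> W' s)) (at s)"
      using has_derivative_inner[OF deriv[OF s, unfolded has_vector_derivative_def]
          deriv[OF s, unfolded has_vector_derivative_def]]
      unfolding has_field_derivative_def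
      by (rule has_derivative_eq_rhs) (auto simp: inner_commute)
    then have "(u has_real_derivative (W s \<bullet> W' s) / u s) (at s)"
      unfolding u_def using inner0[of s]
      by (auto intro!: derivative_eq_intros simp: divide_simps)
    then have "((\<lambda>s. Q (u s)) has_real_derivative (1 / k (u s)) * ((W s \<bullet> W' s) / u s)) (at s)"
      by (rule DERIV_chain2[where f = Q and g = u and x = s, OF QD[OF upos]])
    then have "((\<lambda>s. Q (u s) - Q s) has_real_derivative
        (1 / k (u s)) * ((W s \<bullet> W' s) / u s) - 1 / k s) (at s)"
      by (rule DERIV_diff[OF _ QD[OF s(1)]])
    moreover have "(1 / k (u s)) * ((W s \<bullet> W' s) / u s) \<le> 1 / k s"
    proof -
      have ks: "k s > 0" "k (u s) > 0" using pos s upos[of s] by auto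
      have "W s \<bullet> W' s \<le> norm (W s) * norm (W' s)" by (rule norm_cauchy_schwarz)
      also have "\<dots> \<le> u s * norm (W' s)" by (rule mult_right_mono[OF uW]) simp
      finally have "(W s \<bullet> W' s) / u s \<le> norm (W' s)"
        using upos[of s] by (simp add: divide_simps mult.commute)
      also have "\<dots> \<le> k (norm (W s)) / k s" by (rule speed[OF s])
      also have "\<dots> \<le> k (u s) / k s"
        using ks uW[of s] upos[of s] by (intro divide_right_mono mono_onD[OF mono]) auto
      finally have "(1 / k (u s)) * ((W s \<bullet> W' s) / u s) \<le> (1 / k (u s)) * (k (u s) / k s)"
        using ks by (intro mult_left_mono) auto
      also have "\<dots> = 1 / k s" using ks by simp
      finally show ?thesis .
    qed
    ultimately show "\<exists>y. ((\<lambda>s. Q (u s) - Q s) has_real_derivative y) (at s) \<and> y \<le> 0"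
      by force
  qed
  moreover have "Q (norm (W b)) \<le> Q (u b)"
  proof -
    have "0 \<le> (u b - norm (W b)) / k (u b)"
      using uW[of b] pos[of "u b"] upos[of b] by simp
    then show ?thesis using Qdiff(1)[of "norm (W b)" "u b"] uW[of b] by simp
  qed
  moreover have "Q (u 0) \<le> (Q (norm (W b)) - Q b) / 2"
    using Qdiff(2)[of 0 \<eta>] \<eta> pos[of 0] by (simp add: u_def W0 Q0 \<eta>_def)
  ultimately show False using gap Q0 by simp
qed

text \<open>In integral form this is the Cauchy--Schwarz inequality
  \<open>(\<integral> norm \<phi>')\<^sup>2 \<le> b * \<integral> (norm \<phi>')\<^sup>2 \<le> \<integral> p'\<close>. The derivatives need not be integrable here, so the
  inequality is obtained from the mean value theorem by majorizing \<open>norm \<phi>'\<close> with the weighted mean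
  \<open>b * (norm \<phi>')\<^sup>2 / (2 * N) + N / (2 * b)\<close>, whose weight \<open>N = norm (\<phi> b - \<phi> 0)\<close> is optimal when
  equality holds.\<close>

lemma norm_diff_square_le_of_deriv_square_le:
  fixes \<phi> :: "real \<Rightarrow> 'a::real_normed_vector" and p :: "real \<Rightarrow> real"
  assumes b: "b > 0" and cont\<phi>: "continuous_on {0..b} \<phi>" and contp: "continuous_on {0..b} p"
    and d\<phi>: "\<And>s. 0 < s \<Longrightarrow> s < b \<Longrightarrow> (\<phi> has_vector_derivative \<phi>' s) (at s)"
    and dp: "\<And>s. 0 < s \<Longrightarrow> s < b \<Longrightarrow> (p has_real_derivative p' s) (at s)"
    and le: "\<And>s. 0 < s \<Longrightarrow> s < b \<Longrightarrow> b * (norm (\<phi>' s))\<^sup>2 \<le> p' s"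
  shows "(norm (\<phi> b - \<phi> 0))\<^sup>2 \<le> p b - p 0"
proof -
  define N where "N = norm (\<phi> b - \<phi> 0)"
  show ?thesis
  proof (cases "N = 0")
    case True
    have "p 0 \<le> p b"
    proof (rule DERIV_nonneg_imp_increasing_open[OF _ _ contp])
      fix s assume s: "0 < s" "s < b"
      have "0 \<le> b * (norm (\<phi>' s))\<^sup>2" using b by simp
      then show "\<exists>y. (p has_real_derivative y) (at s) \<and> 0 \<le> y"
        using dp[OF s] le[OF s] by force
    qed (use b in simp)
    then show ?thesis using True by (simp add: N_def)
  next
    case False
    then have N: "N > 0" by (simp add: N_def)
    have "norm (\<phi> b - \<phi> 0) \<le> (p b / (2 * N) + N * b / (2 * b)) - (p 0 / (2 * N) + N * 0 / (2 * b))"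
    proof (rule differentiable_bound_general[OF b cont\<phi> _ d\<phi>,
          where \<phi>' = "\<lambda>s. p' s / (2 * N) + N / (2 * b)"])
      show "continuous_on {0..b} (\<lambda>s. p s / (2 * N) + N * s / (2 * b))"
        using N b by (intro continuous_intros contp) auto
    next
      fix s assume s: "0 < s" "s < b"
      show "((\<lambda>s. p s / (2 * N) + N * s / (2 * b)) has_vector_derivative
          p' s / (2 * N) + N / (2 * b)) (at s)"
        unfolding has_real_derivative_iff_has_vector_derivative[symmetric]
        using N b by (auto intro!: derivative_eq_intros dp[OF s])
      have "0 \<le> (b * norm (\<phi>' s) - N)\<^sup>2" by simp
      then have "2 * N * b * norm (\<phi>' s) \<le> b * (b * (norm (\<phi>' s))\<^sup>2) + N\<^sup>2"
        by (simp add: power2_eq_square algebra_simps)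
      also have "\<dots> \<le> b * p' s + N\<^sup>2"
        using le[OF s] b by simp
      finally show "norm (\<phi>' s) \<le> p' s / (2 * N) + N / (2 * b)"
        using N b by (simp add: field_simps power2_eq_square)
    qed auto
    then have "N \<le> (p b - p 0) / (2 * N) + N / 2"
      using b by (simp add: N_def diff_divide_distrib)
    then have "N\<^sup>2 \<le> p b - p 0"
      using N by (simp add: field_simps power2_eq_square)
    then show ?thesis by (simp add: N_def)
  qed
qed

section \<open>Gradients and Hessians of convex functions\<close>

text \<open>The mean value theorem in the direction \<open>u\<close> turns the second difference into
  \<open>h * (u \<bullet> (g (x + t u + h v) - g (x + t u)))\<close> with \<open>t < h\<close>, and differentiability of \<open>g\<close> at the single
  point \<open>x\<close> evaluates this up to \<open>o(h\<^sup>2)\<close>.\<close>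

lemma mixed_second_difference:
  fixes F :: "'a::real_inner \<Rightarrow> real"
  assumes X: "open X" "x \<in> X" and grad: "\<And>y. y \<in> X \<Longrightarrow> GDERIV F y :> g y"
    and hess: "(g has_derivative H) (at x)" and e: "e > 0"
  shows "\<exists>d>0. \<forall>h. 0 < h \<and> h < d \<longrightarrow>
    \<bar>F (x + h *\<^sub>R u + h *\<^sub>R v) - F (x + h *\<^sub>R u) - F (x + h *\<^sub>R v) + F x - h\<^sup>2 * (u \<bullet> H v)\<bar> \<le> e * h\<^sup>2"
proof -
  define N where "N = norm u + norm v + 1"
  have N: "N > 0" "norm u \<le> N" by (simp_all add: N_def add_nonneg_pos)
  \<comment> \<open>Two remainders, each at most \<open>e' * h * N\<close>, are paired with \<open>u\<close>, where \<open>norm u \<le> N\<close>.\<close>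
  define e' where "e' = e / (2 * N\<^sup>2)"
  have e': "e' > 0" using e N by (simp add: e'_def)
  interpret H: bounded_linear H using hess by (rule has_derivative_bounded_linear)
  obtain d0 where d0: "d0 > 0"
    "\<And>y. norm (y - x) < d0 \<Longrightarrow> norm (g y - g x - H (y - x)) \<le> e' * norm (y - x)"
    using hess e' unfolding has_derivative_at_alt by blast
  obtain r where r: "r > 0" "ball x r \<subseteq> X" using X open_contains_ball by blast
  define d where "d = min d0 r / N"
  have d: "d > 0" using d0 r N by (simp add: d_def)
  have "\<bar>F (x + h *\<^sub>R u + h *\<^sub>R v) - F (x + h *\<^sub>R u) - F (x + h *\<^sub>R v) + F x - h\<^sup>2 * (u \<bullet> H v)\<bar> \<le> e * h\<^sup>2"
    if h: "0 < h" "h < d" for h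
  proof -
    have hN: "h * N < d0" "h * N < r"
      using h N by (auto simp: d_def pos_less_divide_eq)
    have small: "norm (t *\<^sub>R u + c *\<^sub>R v) \<le> h * N" if "0 \<le> t" "t \<le> h" "0 \<le> c" "c \<le> h" for t c
    proof -
      have "norm (t *\<^sub>R u + c *\<^sub>R v) \<le> t * norm u + c * norm v"
        using norm_triangle_ineq[of "t *\<^sub>R u" "c *\<^sub>R v"] that by simp
      also have "\<dots> \<le> h * norm u + h * norm v"
        using that by (intro add_mono mult_right_mono) auto
      also have "\<dots> \<le> h * N" using h by (simp add: N_def algebra_simps)
      finally show ?thesis .
    qed
    have inX: "x + (t *\<^sub>R u + c *\<^sub>R v) \<in> X" if "0 \<le> t" "t \<le> h" "0 \<le> c" "c \<le> h" for t c
    proof -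
      have "dist x (x + (t *\<^sub>R u + c *\<^sub>R v)) < r"
        using small[OF that] hN unfolding dist_norm by (metis add_diff_cancel_left' le_less_trans norm_minus_commute)
      then show ?thesis using r(2) by (meson mem_ball subsetD)
    qed
    have rem: "norm (g (x + (t *\<^sub>R u + c *\<^sub>R v)) - g x - H (t *\<^sub>R u + c *\<^sub>R v)) \<le> e' * (h * N)"
      if "0 \<le> t" "t \<le> h" "0 \<le> c" "c \<le> h" for t c
    proof -
      have "norm (g (x + (t *\<^sub>R u + c *\<^sub>R v)) - g x - H (t *\<^sub>R u + c *\<^sub>R v))
          \<le> e' * norm (t *\<^sub>R u + c *\<^sub>R v)"
        using d0(2)[of "x + (t *\<^sub>R u + c *\<^sub>R v)"] small[OF that] hN by simp
      also have "\<dots> \<le> e' * (h * N)" using small[OF that] e' by (intro mult_left_mono) auto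
      finally show ?thesis .
    qed
    have line: "((\<lambda>t. F (x + (t *\<^sub>R u + c *\<^sub>R v))) has_real_derivative
        u \<bullet> g (x + (t *\<^sub>R u + c *\<^sub>R v))) (at t)" if "0 \<le> t" "t \<le> h" "0 \<le> c" "c \<le> h" for t c
    proof -
      have a: "((\<lambda>t. x + (t *\<^sub>R u + c *\<^sub>R v)) has_derivative (\<lambda>s. s *\<^sub>R u)) (at t)"
        by (auto intro!: derivative_eq_intros)
      from has_derivative_compose[OF a grad[OF inX[OF that], unfolded gderiv_def]]
      show ?thesis
        unfolding has_field_derivative_def by (rule has_derivative_eq_rhs) auto
    qed
    define \<psi> where "\<psi> = (\<lambda>t. F (x + (t *\<^sub>R u + h *\<^sub>R v)) - F (x + (t *\<^sub>R u + 0 *\<^sub>R v)))"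
    define \<psi>' where "\<psi>' = (\<lambda>t. u \<bullet> g (x + (t *\<^sub>R u + h *\<^sub>R v)) - u \<bullet> g (x + (t *\<^sub>R u + 0 *\<^sub>R v)))"
    have "\<exists>t. 0 < t \<and> t < h \<and> \<psi> h - \<psi> 0 = (h - 0) * \<psi>' t"
      unfolding \<psi>_def \<psi>'_def
      by (rule MVT2[OF h(1)]) (use h in \<open>auto intro!: DERIV_diff line simp del: scaleR_zero_left\<close>)
    then obtain t where t: "0 < t" "t < h" "\<psi> h - \<psi> 0 = h * \<psi>' t" by auto
    define r1 where "r1 = g (x + (t *\<^sub>R u + h *\<^sub>R v)) - g x - H (t *\<^sub>R u + h *\<^sub>R v)"
    define r2 where "r2 = g (x + (t *\<^sub>R u + 0 *\<^sub>R v)) - g x - H (t *\<^sub>R u + 0 *\<^sub>R v)"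
    have "\<psi>' t - h * (u \<bullet> H v) = u \<bullet> (r1 - r2)"
      by (simp add: \<psi>'_def r1_def r2_def H.add H.scaleR inner_diff_right inner_add_right)
    also have "\<bar>\<dots>\<bar> \<le> norm u * norm (r1 - r2)" by (rule Cauchy_Schwarz_ineq2)
    also have "\<dots> \<le> N * (2 * (e' * (h * N)))"
    proof (rule mult_mono)
      have "norm (r1 - r2) \<le> norm r1 + norm r2" by (rule norm_triangle_ineq4)
      then show "norm (r1 - r2) \<le> 2 * (e' * (h * N))"
        using rem[of t h] rem[of t 0] t h unfolding r1_def r2_def by auto
    qed (use N in auto)
    also have "\<dots> = e * h" using N by (simp add: e'_def power2_eq_square)
    finally have "\<bar>\<psi>' t - h * (u \<bullet> H v)\<bar> \<le> e * h" .
    then have "h * \<bar>\<psi>' t - h * (u \<bullet> H v)\<bar> \<le> h * (e * h)"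
      using h by (intro mult_left_mono) auto
    also have "h * \<bar>\<psi>' t - h * (u \<bullet> H v)\<bar> = \<bar>\<psi> h - \<psi> 0 - h\<^sup>2 * (u \<bullet> H v)\<bar>"
    proof -
      have "\<psi> h - \<psi> 0 - h\<^sup>2 * (u \<bullet> H v) = h * (\<psi>' t - h * (u \<bullet> H v))"
        using t(3) by (simp add: power2_eq_square algebra_simps)
      then show ?thesis using h by (simp add: abs_mult)
    qed
    finally show ?thesis by (simp add: \<psi>_def power2_eq_square algebra_simps)
  qed
  then show ?thesis using d by blast
qed

text \<open>The second difference is symmetric in \<open>u\<close> and \<open>v\<close>, so both of its expansions have the same leading
  term.\<close>

lemma hessian_symmetric:
  fixes F :: "'a::real_inner \<Rightarrow> real"
  assumes X: "open X" "x \<in> X" and grad: "\<And>y. y \<in> X \<Longrightarrow> GDERIV F y :> g y"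
    and hess: "(g has_derivative H) (at x)"
  shows "u \<bullet> H v = v \<bullet> H u"
proof (rule ccontr)
  assume "u \<bullet> H v \<noteq> v \<bullet> H u"
  define e where "e = \<bar>u \<bullet> H v - v \<bullet> H u\<bar> / 3"
  have e: "e > 0" using \<open>u \<bullet> H v \<noteq> v \<bullet> H u\<close> by (simp add: e_def)
  obtain d1 where d1: "d1 > 0" "\<And>h. 0 < h \<Longrightarrow> h < d1 \<Longrightarrow>
    \<bar>F (x + h *\<^sub>R u + h *\<^sub>R v) - F (x + h *\<^sub>R u) - F (x + h *\<^sub>R v) + F x - h\<^sup>2 * (u \<bullet> H v)\<bar> \<le> e * h\<^sup>2"
    using mixed_second_difference[OF X grad hess e, of u v] by blast
  obtain d2 where d2: "d2 > 0" "\<And>h. 0 < h \<Longrightarrow> h < d2 \<Longrightarrow>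
    \<bar>F (x + h *\<^sub>R v + h *\<^sub>R u) - F (x + h *\<^sub>R v) - F (x + h *\<^sub>R u) + F x - h\<^sup>2 * (v \<bullet> H u)\<bar> \<le> e * h\<^sup>2"
    using mixed_second_difference[OF X grad hess e, of v u] by blast
  define h where "h = min d1 d2 / 2"
  have h: "0 < h" "h < d1" "h < d2" using d1(1) d2(1) by (auto simp: h_def)
  have "x + h *\<^sub>R v + h *\<^sub>R u = x + h *\<^sub>R u + h *\<^sub>R v" by simp
  then have "\<bar>h\<^sup>2 * (u \<bullet> H v) - h\<^sup>2 * (v \<bullet> H u)\<bar> \<le> 2 * (e * h\<^sup>2)"
    using d1(2)[OF h(1,2)] d2(2)[OF h(1,3)] by (simp only: abs_le_iff) linarith
  also have "\<bar>h\<^sup>2 * (u \<bullet> H v) - h\<^sup>2 * (v \<bullet> H u)\<bar> = h\<^sup>2 * (3 * e)"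
    by (simp add: e_def abs_mult flip: right_diff_distrib)
  finally show False using e h by simp
qed

lemma convex_on_above_tangent_plane:
  fixes F :: "'a::real_inner \<Rightarrow> real"
  assumes "convex_on X F" "x \<in> X" "y \<in> X" "GDERIV F x :> D"
  shows "F x + (y - x) \<bullet> D \<le> F y"
proof -
  define \<phi> where "\<phi> = (\<lambda>t. F (x + t *\<^sub>R (y - x)))"
  have a: "((\<lambda>t. x + t *\<^sub>R (y - x)) has_derivative (\<lambda>s. s *\<^sub>R (y - x))) (at 0)"
    by (auto intro!: derivative_eq_intros)
  have b: "(F has_derivative (\<lambda>h. h \<bullet> D)) (at (x + 0 *\<^sub>R (y - x)))"
    using assms(4) by (simp add: gderiv_def)
  have "(\<phi> has_real_derivative (y - x) \<bullet> D) (at 0)"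
    using has_derivative_compose[OF a b] unfolding has_field_derivative_def \<phi>_def
    by (rule has_derivative_eq_rhs) auto
  then have "((\<lambda>h. (\<phi> (0 + h) - \<phi> 0) / h) \<longlongrightarrow> (y - x) \<bullet> D) (at_right 0)"
    unfolding DERIV_def by (rule filterlim_mono) (auto simp: at_le)
  moreover have "eventually (\<lambda>h. (\<phi> (0 + h) - \<phi> 0) / h \<le> F y - F x) (at_right (0::real))"
  proof -
    have "(\<phi> (0 + h) - \<phi> 0) / h \<le> F y - F x" if h: "0 < h" "h < 1" for h
    proof -
      have "F ((1 - h) *\<^sub>R x + h *\<^sub>R y) \<le> (1 - h) * F x + h * F y"
        using assms h by (intro convex_onD) auto
      moreover have "(1 - h) *\<^sub>R x + h *\<^sub>R y = x + h *\<^sub>R (y - x)" by (simp add: algebra_simps)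
      ultimately show ?thesis using h by (simp add: \<phi>_def field_simps)
    qed
    then show ?thesis
      using eventually_at_right_less[of "0::real"] eventually_at_right[of "0::real" 1]
      by (auto intro!: exI[of _ 1])
  qed
  ultimately have "(y - x) \<bullet> D \<le> F y - F x"
    by (rule tendsto_upperbound) simp
  then show ?thesis by simp
qed

text \<open>Nonnegativity of the quadratic form at \<open>L *\<^sub>R v - H v\<close>, together with
  \<open>w \<bullet> H w \<le> L * (norm w)\<^sup>2\<close> for \<open>w = H v\<close>.\<close>

lemma psd_form_cocoercive:
  fixes H :: "'a::real_inner \<Rightarrow> 'a"
  assumes lin: "linear H" and sym: "\<And>u v. u \<bullet> H v = v \<bullet> H u" and psd: "\<And>v. 0 \<le> v \<bullet> H v"
    and bound: "\<And>v. norm (H v) \<le> L * norm v" and L: "L > 0"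
  shows "(norm (H v))\<^sup>2 \<le> L * (v \<bullet> H v)"
proof -
  interpret linear H by (rule lin)
  define w where "w = H v"
  have "w \<bullet> H w \<le> norm w * norm (H w)" by (rule norm_cauchy_schwarz)
  also have "\<dots> \<le> norm w * (L * norm w)" using bound by (intro mult_left_mono) auto
  finally have b: "w \<bullet> H w \<le> L * (w \<bullet> w)" by (simp add: power2_norm_eq_inner[symmetric] power2_eq_square mult.left_commute)
  have "0 \<le> (L *\<^sub>R v - w) \<bullet> H (L *\<^sub>R v - w)" by (rule psd)
  also have "\<dots> = L\<^sup>2 * (v \<bullet> H v) - L * (v \<bullet> H w) - L * (w \<bullet> H v) + w \<bullet> H w"
    by (simp add: diff scale inner_diff_left inner_diff_right power2_eq_square algebra_simps)
  also have "v \<bullet> H w = w \<bullet> w" by (simp add: w_def sym)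
  also have "w \<bullet> H v = w \<bullet> w" by (simp add: w_def)
  finally have "L * (w \<bullet> w) \<le> L * (L * (v \<bullet> H v))"
    using b by (simp add: power2_eq_square algebra_simps)
  then show ?thesis using L by (simp add: w_def power2_norm_eq_inner)
qed

section \<open>One gradient step\<close>

text \<open>The real-valued core of the setting, on the domain \<open>X\<close> where the objective is finite. The last
  assumption is what continuity of the extended-valued objective on the closure of \<open>X\<close> provides: a
  point of the boundary, where the value is \<open>\<infinity>\<close>, is not a limit of points with bounded values.\<close>

locale convex_generalized_smooth =
  fixes X :: "'a::real_inner set" and F :: "'a \<Rightarrow> real" and g :: "'a \<Rightarrow> 'a"
    and H :: "'a \<Rightarrow> 'a \<Rightarrow> 'a" and l :: "real \<Rightarrow> real"
  assumes open_X: "open X" and convex_F: "convex_on X F"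
    and gradient: "y \<in> X \<Longrightarrow> GDERIV F y :> g y"
    and hessian: "y \<in> X \<Longrightarrow> (g has_derivative H y) (at y)"
    and hessian_bound: "y \<in> X \<Longrightarrow> norm (H y v) \<le> l (norm (g y)) * norm v"
    and l_continuous: "continuous_on {0..} l" and l_mono: "mono_on {0..} l"
    and l_pos: "s \<ge> 0 \<Longrightarrow> l s > 0"
    and closed_sublevel: "closed {y \<in> X. F y \<le> c}"
begin

lemma above_tangent: "x \<in> X \<Longrightarrow> y \<in> X \<Longrightarrow> F x + (y - x) \<bullet> g x \<le> F y"
  using convex_on_above_tangent_plane[OF convex_F _ _ gradient] .

lemma gradient_monotone:
  assumes "x \<in> X" "y \<in> X" shows "0 \<le> (y - x) \<bullet> (g y - g x)"
  using above_tangent[OF assms] above_tangent[OF assms(2,1)]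
  by (simp add: inner_diff_left inner_diff_right algebra_simps)

lemma hessian_linear: "y \<in> X \<Longrightarrow> linear (H y)"
  using hessian has_derivative_linear by blast

text \<open>The Hessian is the derivative of a monotone field: \<open>v \<bullet> (g (x + h v) - g x) / h\<close> is nonnegative
  for small \<open>h > 0\<close> and tends to \<open>v \<bullet> H x v\<close>.\<close>

lemma hessian_psd:
  assumes x: "x \<in> X" shows "0 \<le> v \<bullet> H x v"
proof -
  define \<phi> where "\<phi> = (\<lambda>t. v \<bullet> g (x + t *\<^sub>R v))"
  have a: "((\<lambda>t. x + t *\<^sub>R v) has_derivative (\<lambda>s. s *\<^sub>R v)) (at 0)"
    by (auto intro!: derivative_eq_intros)
  have b: "(g has_derivative H x) (at (x + 0 *\<^sub>R v))"
    using hessian[OF x] by simp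
  have "(\<phi> has_real_derivative v \<bullet> H x v) (at 0)"
    unfolding has_field_derivative_def \<phi>_def
    using has_derivative_inner_right[OF has_derivative_compose[OF a b], of v]
    by (rule has_derivative_eq_rhs)
       (auto simp: linear_cmul[OF hessian_linear[OF x]] mult.commute)
  then have lim: "((\<lambda>h. (\<phi> (0 + h) - \<phi> 0) / h) \<longlongrightarrow> v \<bullet> H x v) (at_right 0)"
    unfolding DERIV_def by (rule filterlim_mono) (auto simp: at_le)
  have "((\<lambda>h. x + h *\<^sub>R v) \<longlongrightarrow> x + 0 *\<^sub>R v) (at_right 0)"
    by (intro tendsto_intros)
  then have "eventually (\<lambda>h. x + h *\<^sub>R v \<in> X) (at_right 0)"
    using open_X x topological_tendstoD by fastforce
  then have "eventually (\<lambda>h. 0 \<le> (\<phi> (0 + h) - \<phi> 0) / h) (at_right (0::real))"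
    using eventually_at_right_less[of "0::real"]
  proof eventually_elim
    case (elim h)
    then have "0 \<le> h * (\<phi> (0 + h) - \<phi> 0)"
      using gradient_monotone[OF x, of "x + h *\<^sub>R v"] by (simp add: \<phi>_def inner_diff_right)
    then show ?case using elim by (simp add: zero_le_mult_iff)
  qed
  from tendsto_lowerbound[OF lim this] show ?thesis by simp
qed

lemma hessian_cocoercive:
  assumes x: "x \<in> X" shows "(norm (H x v))\<^sup>2 \<le> l (norm (g x)) * (v \<bullet> H x v)"
  by (rule psd_form_cocoercive[OF hessian_linear[OF x] hessian_symmetric[OF open_X x gradient hessian[OF x]]])
     (auto intro: hessian_psd[OF x] hessian_bound[OF x] l_pos)

definition step_length :: "'a \<Rightarrow> real" where
  "step_length x = integral {0..1} (\<lambda>v. 1 / l (norm (g x) + norm (g x) * v))"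

definition gd_step :: "'a \<Rightarrow> 'a" where
  "gd_step x = x - step_length x *\<^sub>R g x"

text \<open>The segment from \<open>x\<close> to its successor, run through with speed \<open>1 / l (norm (g x) + s)\<close> at time
  \<open>s\<close>. The speed is the reciprocal of the bound on the Hessian that is expected at time \<open>s\<close>, so that
  the gradient moves with speed at most one; the clock is the length travelled up to time \<open>s\<close>.\<close>

definition clock :: "'a \<Rightarrow> real \<Rightarrow> real" where
  "clock x = reciprocal_primitive (\<lambda>v. l (norm (g x) + v))"

definition arc :: "'a \<Rightarrow> real \<Rightarrow> 'a" where
  "arc x s = x - (clock x s / norm (g x)) *\<^sub>R g x"

lemma shifted_l:
  assumes "a \<ge> 0"
  shows shifted_l_continuous: "continuous_on {0..} (\<lambda>v. l (a + v))"
    and shifted_l_mono: "mono_on {0..} (\<lambda>v. l (a + v))"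
  using assms
  by (auto intro!: continuous_on_compose2[OF l_continuous] continuous_intros mono_onI mono_onD[OF l_mono])

lemma clock_continuous: "continuous_on {0..} (clock x)"
  unfolding clock_def
  by (rule continuous_on_reciprocal_primitive[OF shifted_l_continuous]) (auto intro: l_pos)

lemma clock_DERIV: "s > 0 \<Longrightarrow> DERIV (clock x) s :> 1 / l (norm (g x) + s)"
  unfolding clock_def
  by (rule DERIV_reciprocal_primitive[OF shifted_l_continuous]) (auto intro: l_pos)

lemma clock_0 [simp]: "clock x 0 = 0"
  by (simp add: clock_def reciprocal_primitive_def)

lemma arc_0 [simp]: "arc x 0 = x"
  by (simp add: arc_def)

text \<open>The substitution \<open>s = norm (g x) * v\<close> turns the step-size integral into the clock. Hence the
  successor of \<open>x\<close> is reached exactly at time \<open>norm (g x)\<close>, which is why the step size has this form.\<close>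

lemma norm_gradient_times_step: "norm (g x) * step_length x = clock x (norm (g x))"
proof -
  let ?a = "norm (g x)"
  have "((\<lambda>v. ?a * (1 / l (?a + ?a * v))) has_integral clock x (?a * 1) - clock x (?a * 0)) {0..1}"
  proof (rule fundamental_theorem_of_calculus_interior)
    show "continuous_on {0..1} (\<lambda>v. clock x (?a * v))"
      by (intro continuous_on_compose2[OF clock_continuous] continuous_intros) auto
    fix v :: real assume v: "v \<in> {0<..<1}"
    show "((\<lambda>v. clock x (?a * v)) has_vector_derivative ?a * (1 / l (?a + ?a * v))) (at v)"
    proof (cases "?a = 0")
      case False
      have "((\<lambda>v. clock x (?a * v)) has_real_derivative (1 / l (?a + ?a * v)) * ?a) (at v)"
        by (rule DERIV_chain2[where f = "clock x", OF clock_DERIV])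
           (use v False in \<open>auto intro!: derivative_eq_intros\<close>)
      then show ?thesis
        by (simp add: has_real_derivative_iff_has_vector_derivative mult.commute)
    qed simp
  qed simp
  then have "integral {0..1} (\<lambda>v. ?a * (1 / l (?a + ?a * v))) = clock x ?a"
    by (simp add: integral_unique)
  then show ?thesis
    by (simp only: step_length_def integral_mult_right)
qed

lemma arc_end: "g x \<noteq> 0 \<Longrightarrow> arc x (norm (g x)) = gd_step x"
  by (simp add: arc_def gd_step_def flip: norm_gradient_times_step)

lemma arc_continuous: "continuous_on {0..} (arc x)"
  unfolding arc_def divide_inverse by (intro continuous_intros clock_continuous)

lemma arc_deriv:
  assumes "s > 0"
  shows "(arc x has_vector_derivative - (1 / (l (norm (g x) + s) * norm (g x))) *\<^sub>R g x) (at s)"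
proof -
  have "((\<lambda>s. clock x s / norm (g x)) has_real_derivative 1 / l (norm (g x) + s) / norm (g x)) (at s)"
    by (rule DERIV_cdivide[OF clock_DERIV[OF assms]])
  from has_vector_derivative_diff[OF has_vector_derivative_const
      has_vector_derivative_scaleR[OF this has_vector_derivative_const]]
  show ?thesis unfolding arc_def by simp
qed

lemma gradient_along_arc_deriv:
  assumes "s > 0" "arc x s \<in> X"
  shows "((\<lambda>s. g (arc x s)) has_vector_derivative
    - (1 / (l (norm (g x) + s) * norm (g x))) *\<^sub>R H (arc x s) (g x)) (at s)"
proof -
  have "((\<lambda>s. g (arc x s)) has_vector_derivative
    H (arc x s) (- (1 / (l (norm (g x) + s) * norm (g x))) *\<^sub>R g x)) (at s)"
    using has_derivative_compose[OF arc_deriv[OF assms(1), unfolded has_vector_derivative_def] hessian[OF assms(2)]]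
    unfolding has_vector_derivative_def
    by (rule has_derivative_eq_rhs) (simp only: linear_cmul[OF hessian_linear[OF assms(2)]])
  then show ?thesis by (simp only: linear_cmul[OF hessian_linear[OF assms(2)]])
qed

lemma function_along_arc_deriv:
  assumes "s > 0" "arc x s \<in> X"
  shows "((\<lambda>s. F (arc x s)) has_real_derivative
    - (g x \<bullet> g (arc x s)) / (l (norm (g x) + s) * norm (g x))) (at s)"
  using has_derivative_compose[OF arc_deriv[OF assms(1), unfolded has_vector_derivative_def]
      gradient[OF assms(2), unfolded gderiv_def]]
  unfolding has_field_derivative_def
  by (rule has_derivative_eq_rhs) auto

lemma gradient_continuous: "continuous_on X g"
  using hessian has_derivative_continuous continuous_at_imp_continuous_on by blast

lemma function_continuous: "continuous_on X F"
  using gradient[unfolded gderiv_def] has_derivative_continuous continuous_at_imp_continuous_on by blast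

lemma
  assumes arc: "\<And>s. 0 \<le> s \<Longrightarrow> s \<le> b \<Longrightarrow> arc x s \<in> X"
  shows gradient_along_arc_continuous: "continuous_on {0..b} (\<lambda>s. g (arc x s))"
    and function_along_arc_continuous: "continuous_on {0..b} (\<lambda>s. F (arc x s))"
proof -
  have "continuous_on {0..b} (arc x)"
    by (rule continuous_on_subset[OF arc_continuous]) auto
  then show "continuous_on {0..b} (\<lambda>s. g (arc x s))" "continuous_on {0..b} (\<lambda>s. F (arc x s))"
    using arc by (auto intro: continuous_on_compose2[OF gradient_continuous] continuous_on_compose2[OF function_continuous])
qed

text \<open>At time \<open>s\<close> the gradient moves with speed at most \<open>l (norm (g (arc x s))) / l (norm (g x) + s)\<close>.
  The numerator depends on the very quantity to be bounded, so the estimate is an instance of the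
  comparison lemma for the function \<open>\<lambda>s. l (norm (g x) + s)\<close>.\<close>

lemma gradient_change_along_arc:
  assumes nz: "g x \<noteq> 0" and b: "b \<ge> 0"
    and arc: "\<And>s. 0 \<le> s \<Longrightarrow> s \<le> b \<Longrightarrow> arc x s \<in> X"
  shows "norm (g (arc x b) - g x) \<le> b"
proof -
  let ?a = "norm (g x)"
  have a: "?a > 0" using nz by simp
  show ?thesis
  proof (rule norm_le_of_reciprocal_speed[where k = "\<lambda>s. l (?a + s)" and W = "\<lambda>s. g (arc x s) - g x"])
    fix s assume s: "0 < s" "s < b"
    have X: "arc x s \<in> X" using arc s by simp
    show "((\<lambda>s. g (arc x s) - g x) has_vector_derivative
        - (1 / (l (?a + s) * ?a)) *\<^sub>R H (arc x s) (g x)) (at s)"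
      using has_vector_derivative_diff[OF gradient_along_arc_deriv[OF s(1) X] has_vector_derivative_const]
      by simp
    have l: "l (?a + s) > 0" using l_pos s by simp
    have "norm (- (1 / (l (?a + s) * ?a)) *\<^sub>R H (arc x s) (g x)) = norm (H (arc x s) (g x)) / (l (?a + s) * ?a)"
      using l a by (simp add: abs_mult)
    also have "\<dots> \<le> (l (norm (g (arc x s))) * ?a) / (l (?a + s) * ?a)"
      using l a by (intro divide_right_mono hessian_bound[OF X]) auto
    also have "\<dots> = l (norm (g (arc x s))) / l (?a + s)"
      using a by simp
    also have "\<dots> \<le> l (?a + norm (g (arc x s) - g x)) / l (?a + s)"
      using l norm_triangle_ineq[of "g x" "g (arc x s) - g x"]
      by (intro divide_right_mono mono_onD[OF l_mono]) auto
    finally show "norm (- (1 / (l (?a + s) * ?a)) *\<^sub>R H (arc x s) (g x))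
      \<le> l (?a + norm (g (arc x s) - g x)) / l (?a + s)" .
  next
    show "continuous_on {0..b} (\<lambda>s. g (arc x s) - g x)"
      by (intro continuous_intros gradient_along_arc_continuous arc)
  qed (use b in \<open>auto intro: shifted_l_continuous shifted_l_mono l_pos\<close>)
qed

text \<open>By the previous estimate, \<open>F\<close> decreases along the arc at least at the rate
  \<open>(norm (g x) - s) / l (norm (g x) + s)\<close>. Both factors decrease with \<open>s\<close>, so by Chebyshev's
  integral inequality the first one may be replaced by its mean \<open>norm (g x) / 2\<close> over the whole arc, and
  the second one integrates to the clock.\<close>

lemma descent_along_arc:
  assumes nz: "g x \<noteq> 0" and b: "0 \<le> b" "b \<le> norm (g x)"
    and arc: "\<And>s. 0 \<le> s \<Longrightarrow> s \<le> b \<Longrightarrow> arc x s \<in> X"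
  shows "F (arc x b) \<le> F x - norm (g x) / 2 * clock x b"
proof -
  let ?a = "norm (g x)"
  have a: "?a > 0" using nz by simp
  \<comment> \<open>The denominator at the time when the factor \<open>norm (g x) - s\<close> equals its mean: replacing
    \<open>l (norm (g x) + s)\<close> by \<open>c\<close> can only increase \<open>(s - norm (g x) / 2) / l (norm (g x) + s)\<close>.\<close>
  define c where "c = l (?a + ?a / 2)"
  have c: "c > 0" using l_pos a by (simp add: c_def)
  define \<Phi> where "\<Phi> = (\<lambda>s. F (arc x s) + ?a / 2 * clock x s - (s\<^sup>2 - ?a * s) / (2 * c))"
  have "\<Phi> b \<le> \<Phi> 0"
  proof (rule DERIV_nonpos_imp_decreasing_open[OF b(1)])
    show "continuous_on {0..b} \<Phi>"
      unfolding \<Phi>_def using c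
      by (intro continuous_intros function_along_arc_continuous arc
            continuous_on_subset[OF clock_continuous]) auto
  next
    fix s assume s: "0 < s" "s < b"
    have X: "arc x s \<in> X" using arc s by simp
    let ?k = "l (?a + s)"
    have k: "?k > 0" using l_pos s by simp
    have "DERIV \<Phi> s :> - (g x \<bullet> g (arc x s)) / (?k * ?a) + ?a / 2 * (1 / ?k) - (2 * s - ?a) / (2 * c)"
      unfolding \<Phi>_def using c
      by (auto intro!: derivative_eq_intros function_along_arc_deriv[OF s(1) X] clock_DERIV[OF s(1)])
         (simp add: field_simps)
    moreover have "- (g x \<bullet> g (arc x s)) / (?k * ?a) + ?a / 2 * (1 / ?k) \<le> (2 * s - ?a) / (2 * c)"
    proof -
      have "- (g x \<bullet> (g (arc x s) - g x)) \<le> ?a * norm (g (arc x s) - g x)"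
        using Cauchy_Schwarz_ineq2[of "g x" "g (arc x s) - g x"] by linarith
      also have "\<dots> \<le> ?a * s"
        using gradient_change_along_arc[OF nz, of s] arc s a by (intro mult_left_mono) auto
      finally have "- (g x \<bullet> g (arc x s)) \<le> ?a * (s - ?a)"
        by (simp add: inner_diff_right algebra_simps power2_norm_eq_inner[symmetric] power2_eq_square)
      then have "- (g x \<bullet> g (arc x s)) / (?k * ?a) \<le> (?a * (s - ?a)) / (?k * ?a)"
        using k a by (intro divide_right_mono) auto
      also have "\<dots> = (s - ?a) / ?k" using a by simp
      finally have "- (g x \<bullet> g (arc x s)) / (?k * ?a) \<le> (s - ?a) / ?k" .
      moreover have "(s - ?a) / ?k + ?a / 2 * (1 / ?k) = (2 * s - ?a) / (2 * ?k)"
        using k by (simp add: field_simps)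
      ultimately have "- (g x \<bullet> g (arc x s)) / (?k * ?a) + ?a / 2 * (1 / ?k) \<le> (2 * s - ?a) / (2 * ?k)"
        by linarith
      also have "\<dots> \<le> (2 * s - ?a) / (2 * c)"
      proof (cases "2 * s \<ge> ?a")
        case True
        then have "c \<le> ?k" unfolding c_def using a s by (intro mono_onD[OF l_mono]) auto
        then show ?thesis using True c k by (intro divide_left_mono) auto
      next
        case False
        then have "?k \<le> c" unfolding c_def using a s by (intro mono_onD[OF l_mono]) auto
        then show ?thesis using False c k by (intro divide_left_mono_neg) auto
      qed
      finally show ?thesis .
    qed
    ultimately show "\<exists>y. DERIV \<Phi> s :> y \<and> y \<le> 0" by force
  qed
  moreover have "(b\<^sup>2 - ?a * b) / (2 * c) \<le> 0"
    using b c by (intro divide_nonpos_pos) (auto simp: power2_eq_square mult_right_mono)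
  ultimately show ?thesis by (simp add: \<Phi>_def)
qed

lemma clock_nonneg:
  assumes "s \<ge> 0" shows "clock x s \<ge> 0"
proof -
  have "0 \<le> (s - 0) / l (norm (g x) + s)"
    using assms l_pos[of "norm (g x) + s"] by simp
  also have "\<dots> \<le> clock x s - clock x 0"
    unfolding clock_def using assms
    by (intro reciprocal_primitive_diff_ge shifted_l_continuous shifted_l_mono) (auto intro: l_pos)
  finally show ?thesis by simp
qed

text \<open>At a first exit time the arc would be a limit of points of one sublevel set, because \<open>F\<close> does not
  exceed \<open>F x\<close> before; as sublevel sets are closed, the exit point would lie in the domain.\<close>

lemma arc_in_domain:
  assumes x: "x \<in> X" and nz: "g x \<noteq> 0" and s: "0 \<le> s" "s \<le> norm (g x)"
  shows "arc x s \<in> X"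
proof (rule ccontr)
  assume out: "arc x s \<notin> X"
  define B where "B = {0..norm (g x)} \<inter> arc x -` (- X)"
  have "continuous_on {0..norm (g x)} (arc x)"
    by (rule continuous_on_subset[OF arc_continuous]) auto
  then have "closed B"
    unfolding B_def using open_X by (intro continuous_closed_preimage) auto
  moreover have "bounded B" unfolding B_def by (rule bounded_subset[of "{0..norm (g x)}"]) auto
  ultimately have "compact B" by (simp add: compact_eq_bounded_closed)
  moreover have "B \<noteq> {}" using out s by (auto simp: B_def)
  ultimately obtain t where t: "t \<in> B" "\<And>r. r \<in> B \<Longrightarrow> t \<le> r"
    using compact_attains_inf by metis
  have t0: "0 < t" "t \<le> norm (g x)" "arc x t \<notin> X"
    using t(1) x by (auto simp: B_def less_le)
  have before: "arc x r \<in> X" if "0 \<le> r" "r < t" for r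
    using t(2)[of r] that t0(2) by (force simp: B_def)
  have "(arc x \<longlongrightarrow> arc x t) (at_left t)"
  proof -
    have "isCont (arc x) t"
      using arc_deriv[OF t0(1)] has_vector_derivative_continuous by blast
    then show ?thesis by (simp add: isCont_def filterlim_at_split)
  qed
  moreover have "eventually (\<lambda>r. arc x r \<in> {y \<in> X. F y \<le> F x}) (at_left t)"
  proof -
    have "arc x r \<in> {y \<in> X. F y \<le> F x}" if r: "0 < r" "r < t" for r
    proof -
      have "F (arc x r) \<le> F x - norm (g x) / 2 * clock x r"
        using r t0 by (intro descent_along_arc[OF nz] before) auto
      moreover have "0 \<le> norm (g x) / 2 * clock x r" using clock_nonneg r by simp
      ultimately show ?thesis using before[of r] r by simp
    qed
    then show ?thesis
      using eventually_at_left[OF t0(1)] t0(1) by blast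
  qed
  ultimately have "arc x t \<in> {y \<in> X. F y \<le> F x}"
    by (intro Lim_in_closed_set[OF closed_sublevel]) auto
  then show False using t0(3) by simp
qed

lemma gd_step_in_domain:
  assumes "x \<in> X" shows "gd_step x \<in> X"
proof (cases "g x = 0")
  case False
  then show ?thesis using arc_in_domain[OF assms False, of "norm (g x)"] by (simp add: arc_end)
qed (use assms in \<open>simp add: gd_step_def\<close>)

lemma descent:
  assumes "x \<in> X" shows "F (gd_step x) \<le> F x - step_length x / 2 * (norm (g x))\<^sup>2"
proof (cases "g x = 0")
  case False
  have "F (arc x (norm (g x))) \<le> F x - norm (g x) / 2 * clock x (norm (g x))"
    by (intro descent_along_arc arc_in_domain False assms) auto
  then show ?thesis
    using False by (simp add: arc_end power2_eq_square mult_ac flip: norm_gradient_times_step)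
qed (simp add: gd_step_def)

text \<open>Cocoercivity of the gradient along the arc. The bound \<open>l (norm (g x) + s)\<close> for the Hessian at time
  \<open>s\<close> cancels the speed of the arc, so the pointwise inequality \<open>(norm (H v))\<^sup>2 \<le> L * (v \<bullet> H v)\<close> integrates to
  \<open>(norm (g x' - g x))\<^sup>2 \<le> g x \<bullet> (g x - g x')\<close> for the successor \<open>x'\<close>, with constant one. Expanding the
  square, this is \<open>(norm (g x'))\<^sup>2 \<le> g x \<bullet> g x'\<close>, whence \<open>norm (g x') \<le> norm (g x)\<close>.\<close>

lemma gradient_norm_antimono:
  assumes x: "x \<in> X" shows "norm (g (gd_step x)) \<le> norm (g x)"
proof (cases "g x = 0")
  case nz: False
  let ?a = "norm (g x)"
  have a: "?a > 0" using nz by simp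
  have arc: "arc x s \<in> X" if "0 \<le> s" "s \<le> ?a" for s
    using arc_in_domain[OF x nz that] .
  note gcont = gradient_along_arc_continuous[OF arc, of ?a, simplified]
  have "(norm (g (arc x ?a) - g (arc x 0)))\<^sup>2 \<le> - (g x \<bullet> g (arc x ?a)) - - (g x \<bullet> g (arc x 0))"
  proof (rule norm_diff_square_le_of_deriv_square_le[OF a])
    show "continuous_on {0..?a} (\<lambda>s. - (g x \<bullet> g (arc x s)))"
      by (intro continuous_intros gcont)
  next
    fix s assume s: "0 < s" "s < ?a"
    have X: "arc x s \<in> X" using arc s by simp
    let ?k = "l (?a + s)" and ?h = "H (arc x s) (g x)"
    have k: "?k > 0" using l_pos s by simp
    show deriv: "((\<lambda>s. g (arc x s)) has_vector_derivative - (1 / (?k * ?a)) *\<^sub>R ?h) (at s)"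
      by (rule gradient_along_arc_deriv[OF s(1) X])
    have "((\<lambda>s. g x \<bullet> g (arc x s)) has_real_derivative g x \<bullet> (- (1 / (?k * ?a)) *\<^sub>R ?h)) (at s)"
      using has_derivative_inner_right[OF deriv[unfolded has_vector_derivative_def], of "g x"]
      unfolding has_field_derivative_def
      by (rule has_derivative_eq_rhs) (auto simp: mult.commute)
    from DERIV_minus[OF this]
    show "((\<lambda>s. - (g x \<bullet> g (arc x s))) has_real_derivative (g x \<bullet> ?h) / (?k * ?a)) (at s)"
      by simp
    have "norm (g (arc x s)) \<le> ?a + norm (g (arc x s) - g x)"
      using norm_triangle_ineq[of "g x" "g (arc x s) - g x"] by simp
    also have "\<dots> \<le> ?a + s"
      using gradient_change_along_arc[OF nz, of s] arc s by simp
    finally have "l (norm (g (arc x s))) \<le> ?k"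
      using s by (intro mono_onD[OF l_mono]) auto
    then have "l (norm (g (arc x s))) * (g x \<bullet> ?h) \<le> ?k * (g x \<bullet> ?h)"
      using hessian_psd[OF X] by (rule mult_right_mono)
    then have "(norm ?h)\<^sup>2 \<le> ?k * (g x \<bullet> ?h)"
      using hessian_cocoercive[OF X, of "g x"] by linarith
    then have "?a * ((norm ?h)\<^sup>2 / (?k * ?a)\<^sup>2) \<le> ?a * (?k * (g x \<bullet> ?h) / (?k * ?a)\<^sup>2)"
      using a by (intro mult_left_mono divide_right_mono) auto
    also have "\<dots> = (g x \<bullet> ?h) / (?k * ?a)"
      using a k by (simp add: power2_eq_square)
    finally show "?a * (norm (- (1 / (?k * ?a)) *\<^sub>R ?h))\<^sup>2 \<le> (g x \<bullet> ?h) / (?k * ?a)"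
      using a k by (simp add: power_divide power_mult_distrib)
  qed (rule gcont)
  then have "(norm (g (gd_step x) - g x))\<^sup>2 \<le> g x \<bullet> g x - g x \<bullet> g (gd_step x)"
    using nz by (simp add: arc_end)
  moreover have "0 \<le> (norm (g (gd_step x) - g x))\<^sup>2" by simp
  ultimately have "(norm (g (gd_step x)))\<^sup>2 \<le> (norm (g x))\<^sup>2"
    unfolding power2_norm_eq_inner by (simp add: inner_diff_left inner_diff_right inner_commute)
  then show ?thesis by (rule power2_le_imp_le) simp
qed (simp add: gd_step_def)

lemma step_length_ge:
  assumes "norm (g x) \<le> M" shows "1 / l (2 * M) \<le> step_length x"
proof -
  have "continuous_on {0..1} (\<lambda>v. 1 / l (norm (g x) + norm (g x) * v))"
  proof (intro continuous_intros continuous_on_compose2[OF l_continuous])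
    show "\<forall>v\<in>{0..1}. l (norm (g x) + norm (g x) * v) \<noteq> 0"
      using l_pos by (metis add_nonneg_nonneg atLeastAtMost_iff less_irrefl mult_nonneg_nonneg norm_ge_zero)
  qed auto
  then have int: "(\<lambda>v. 1 / l (norm (g x) + norm (g x) * v)) integrable_on {0..1}"
    by (rule integrable_continuous_real)
  have "1 / l (2 * M) \<le> 1 / l (norm (g x) + norm (g x) * v)" if "0 \<le> v" "v \<le> 1" for v
  proof -
    have "norm (g x) * v \<le> norm (g x)" using that by (simp add: mult_left_le)
    then have "l (norm (g x) + norm (g x) * v) \<le> l (2 * M)"
      using assms that order_trans[OF norm_ge_zero assms] by (intro mono_onD[OF l_mono]) auto
    moreover have "0 < l (norm (g x) + norm (g x) * v)"
      by (rule l_pos) (use that in simp)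
    ultimately show ?thesis by (intro divide_left_mono mult_pos_pos) auto
  qed
  then have "integral {0..1::real} (\<lambda>v. 1 / l (2 * M)) \<le> step_length x"
    unfolding step_length_def by (intro integral_le int) auto
  then show ?thesis by simp
qed

lemma step_length_pos: "step_length x > 0"
  using step_length_ge[of x "norm (g x)"] l_pos[of "2 * norm (g x)"]
  by (smt (verit) norm_ge_zero zero_less_divide_1_iff)

text \<open>The standard potential of gradient descent: the term \<open>(step_length x)\<^sup>2 * (norm (g x))\<^sup>2\<close> from expanding
  the square is paid for by the descent inequality, and the cross term is bounded by convexity.\<close>

lemma distance_decrease:
  assumes x: "x \<in> X" and z: "z \<in> X"
  shows "(norm (gd_step x - z))\<^sup>2 \<le> (norm (x - z))\<^sup>2 - 2 * step_length x * (F (gd_step x) - F z)"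
proof -
  have "(norm (gd_step x - z))\<^sup>2 = (norm (x - z))\<^sup>2 - 2 * step_length x * ((x - z) \<bullet> g x) + (step_length x)\<^sup>2 * (norm (g x))\<^sup>2"
    unfolding power2_norm_eq_inner gd_step_def
    by (simp add: inner_diff_left inner_diff_right inner_commute power2_eq_square algebra_simps)
  moreover have "2 * step_length x * (F x - F z) \<le> 2 * step_length x * ((x - z) \<bullet> g x)"
    using above_tangent[OF x z] step_length_pos[of x]
    by (intro mult_left_mono) (auto simp: inner_diff_left)
  moreover have "2 * step_length x * (step_length x / 2 * (norm (g x))\<^sup>2) \<le> 2 * step_length x * (F x - F (gd_step x))"
    using descent[OF x] step_length_pos[of x] by (intro mult_left_mono) auto
  ultimately show ?thesis by (simp add: power2_eq_square algebra_simps)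
qed

section \<open>The convergence rate\<close>

context
  fixes x :: "nat \<Rightarrow> 'a" and z :: 'a
  assumes x0: "x 0 \<in> X" and iter: "x (Suc k) = gd_step (x k)"
    and z: "z \<in> X" and z_min: "y \<in> X \<Longrightarrow> F z \<le> F y"
begin

lemma iterate_in_domain: "x k \<in> X"
  by (induction k) (auto simp: x0 iter gd_step_in_domain)

lemma iterate_distance_antimono: "(norm (x k - z))\<^sup>2 \<le> (norm (x 0 - z))\<^sup>2"
proof (induction k)
  case (Suc k)
  have "0 \<le> 2 * step_length (x k) * (F (gd_step (x k)) - F z)"
    using z_min[OF gd_step_in_domain[OF iterate_in_domain]] step_length_pos[of "x k"] by simp
  then have "(norm (x (Suc k) - z))\<^sup>2 \<le> (norm (x k - z))\<^sup>2"
    using distance_decrease[OF iterate_in_domain[of k] z] unfolding iter by linarith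
  then show ?case using Suc by (rule order_trans)
qed simp

lemma iterate_gradient_antimono: "norm (g (x (k + j))) \<le> norm (g (x k))"
proof (induction j)
  case (Suc j)
  then show ?case
    using gradient_norm_antimono[OF iterate_in_domain[of "k + j"]] by (simp add: iter)
qed simp

text \<open>The gradient stays below \<open>M\<close> from iteration \<open>k\<close> on, so every later step has length at least
  \<open>1 / l (2 * M)\<close>. Telescoping the decrease of the distance then gives the rate of gradient descent
  for a function whose gradient has the Lipschitz constant \<open>l (2 * M)\<close>.\<close>

lemma suboptimality_after_small_gradient:
  assumes M: "norm (g (x k)) \<le> M"
  shows "2 * real j * (F (x (k + j)) - F z) \<le> l (2 * M) * (norm (x 0 - z))\<^sup>2"
proof -
  define L where "L = l (2 * M)"
  have L: "L > 0" using l_pos order_trans[OF norm_ge_zero M] by (simp add: L_def)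
  have "2 * real j / L * (F (x (k + j)) - F z) \<le> (norm (x k - z))\<^sup>2 - (norm (x (k + j) - z))\<^sup>2"
  proof (induction j)
    case (Suc j)
    let ?y = "x (k + j)" and ?y' = "x (k + Suc j)"
    have y: "?y \<in> X" by (rule iterate_in_domain)
    have y': "?y' = gd_step ?y" by (simp add: iter)
    have "0 \<le> step_length ?y / 2 * (norm (g ?y))\<^sup>2" using step_length_pos[of ?y] by simp
    then have dec: "F ?y' \<le> F ?y" using descent[OF y] unfolding y' by linarith
    have opt: "0 \<le> F ?y' - F z" using z_min[OF iterate_in_domain[of "k + Suc j"]] by simp
    have "2 * real (Suc j) / L * (F ?y' - F z) = 2 * real j / L * (F ?y' - F z) + 2 * (1 / L) * (F ?y' - F z)"
      by (simp add: add_divide_distrib algebra_simps)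
    also have "\<dots> \<le> 2 * real j / L * (F ?y - F z) + 2 * step_length ?y * (F ?y' - F z)"
      using dec opt L order_trans[OF iterate_gradient_antimono M, of j]
      by (intro add_mono mult_left_mono mult_right_mono) (auto simp: L_def intro!: step_length_ge[simplified])
    also have "\<dots> \<le> ((norm (x k - z))\<^sup>2 - (norm (?y - z))\<^sup>2) + ((norm (?y - z))\<^sup>2 - (norm (?y' - z))\<^sup>2)"
      using distance_decrease[OF y z] unfolding y' by (intro add_mono Suc.IH[unfolded y']) linarith
    finally show ?case by simp
  qed simp
  also have "\<dots> \<le> (norm (x 0 - z))\<^sup>2"
    using iterate_distance_antimono[of k] by (smt (verit) zero_le_power2)
  finally show ?thesis using L by (simp add: L_def field_simps)
qed

end

end

section \<open>Extended-valued objectives\<close>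

lemma GDERIV_grad:
  fixes f :: "real ^ 'n \<Rightarrow> ereal"
  assumes "(\<lambda>y. real_of_ereal (f y)) differentiable (at x)"
  shows "GDERIV (\<lambda>y. real_of_ereal (f y)) x :> grad f x"
proof -
  obtain f' where f': "((\<lambda>y. real_of_ereal (f y)) has_derivative f') (at x)"
    using assms by (auto simp: differentiable_def)
  have "f' = (\<lambda>h. h \<bullet> adjoint f' 1)"
    using adjoint_works[OF has_derivative_linear[OF f'], of _ 1] by (auto simp: fun_eq_iff)
  then have "GDERIV (\<lambda>y. real_of_ereal (f y)) x :> adjoint f' 1"
    using f' by (simp add: gderiv_def)
  moreover have "D = adjoint f' 1" if "GDERIV (\<lambda>y. real_of_ereal (f y)) x :> D" for D
  proof -
    have "(\<lambda>h. h \<bullet> D) = f'"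
      using has_derivative_unique that f' unfolding gderiv_def by blast
    with \<open>f' = (\<lambda>h. h \<bullet> adjoint f' 1)\<close> have "\<And>h. h \<bullet> D = h \<bullet> adjoint f' 1"
      by metis
    then show ?thesis by (metis vector_eq_ldot)
  qed
  ultimately show ?thesis
    unfolding grad_def by (rule theI2) auto
qed

lemma hessian_norm_bound:
  assumes "grad f differentiable (at x)"
  shows "norm (frechet_derivative (grad f) (at x) v) \<le> spectral_norm (hessian f x) * norm v"
proof -
  have lin: "linear (frechet_derivative (grad f) (at x))"
    by (rule linear_frechet_derivative[OF assms])
  then have "bounded_linear (\<lambda>v. hessian f x *v v)"
    by (intro linear_conv_bounded_linear[THEN iffD1]) simp
  from onorm[OF this, of v] show ?thesis
    using lin by (simp add: spectral_norm_def hessian_def matrix_works linear_matrix_vector_mul_eq)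
qed

lemma ell_smooth_convex_generalized_smooth:
  fixes f :: "real ^ 'n \<Rightarrow> ereal"
  assumes smooth: "ell_smooth l f" and convex: "convex_ereal f"
  shows "convex_generalized_smooth (eff_dom f) (\<lambda>y. real_of_ereal (f y)) (grad f)
    (\<lambda>y. frechet_derivative (grad f) (at y)) l"
proof
  let ?X = "eff_dom f" and ?F = "\<lambda>y. real_of_ereal (f y)"
  have fin: "f y = ereal (?F y)" if "y \<in> ?X" for y
    using smooth that by (cases "f y") (auto simp: ell_smooth_def eff_dom_def)
  show "open ?X" using smooth by (simp add: ell_smooth_def)
  show "continuous_on {0..} l"
    using smooth local_lipschitz_continuous_on[of "UNIV :: real set" "{0..}" "\<lambda>_. l" 0]
    by (simp add: ell_smooth_def)
  show "mono_on {0..} l" using smooth by (simp add: ell_smooth_def)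
  show "l s > 0" if "s \<ge> 0" for s using smooth that by (simp add: ell_smooth_def)
  show "convex_on ?X ?F"
  proof (rule convex_onI)
    show "convex ?X" using smooth by (simp add: ell_smooth_def)
    fix t :: real and x y assume t: "0 < t" "t < 1" and xy: "x \<in> ?X" "y \<in> ?X"
    have "(1 - t) *\<^sub>R x + t *\<^sub>R y \<in> ?X"
      using convexD_alt[OF \<open>convex ?X\<close> xy, of t] t by simp
    from fin[OF this] have "ereal (?F ((1 - t) *\<^sub>R x + t *\<^sub>R y)) = f ((1 - t) *\<^sub>R x + t *\<^sub>R y)" by simp
    also have "\<dots> \<le> ereal (1 - t) * f x + ereal t * f y"
      using convex t by (simp add: convex_ereal_def)
    also have "\<dots> = ereal ((1 - t) * ?F x + t * ?F y)"
      by (subst fin[OF xy(1)], subst fin[OF xy(2)]) simp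
    finally show "?F ((1 - t) *\<^sub>R x + t *\<^sub>R y) \<le> (1 - t) * ?F x + t * ?F y" by simp
  qed
  fix y assume y: "y \<in> ?X"
  show "GDERIV ?F y :> grad f y"
    using smooth y by (intro GDERIV_grad) (simp add: ell_smooth_def twice_differentiable_on_def)
  have diff: "grad f differentiable (at y)"
    using smooth y by (simp add: ell_smooth_def twice_differentiable_on_def)
  then show "(grad f has_derivative frechet_derivative (grad f) (at y)) (at y)"
    by (simp add: frechet_derivative_works)
  fix v
  have "norm (frechet_derivative (grad f) (at y) v) \<le> spectral_norm (hessian f y) * norm v"
    by (rule hessian_norm_bound[OF diff])
  also have "\<dots> \<le> l (norm (grad f y)) * norm v"
    using smooth y by (intro mult_right_mono) (auto simp: ell_smooth_def)
  finally show "norm (frechet_derivative (grad f) (at y) v) \<le> l (norm (grad f y)) * norm v" .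
next
  fix c
  have "{y \<in> eff_dom f. real_of_ereal (f y) \<le> c} = closure (eff_dom f) \<inter> f -` {..ereal c}"
  proof -
    have "real_of_ereal (f y) \<le> c \<longleftrightarrow> f y \<le> ereal c" if "y \<in> eff_dom f" for y
      using smooth that by (cases "f y") (auto simp: ell_smooth_def eff_dom_def)
    moreover have "y \<in> eff_dom f" if "f y \<le> ereal c" for y
      using that by (auto simp: eff_dom_def intro: le_less_trans)
    ultimately show ?thesis using closure_subset[of "eff_dom f"] by auto
  qed
  also have "closed \<dots>"
    using smooth by (intro continuous_closed_preimage) (auto simp: ell_smooth_def)
  finally show "closed {y \<in> eff_dom f. real_of_ereal (f y) \<le> c}" .
qed

lemma iters_to_grad_attained:
  assumes "iters_to_grad f x M \<noteq> \<infinity>"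
  obtains k where "iters_to_grad f x M = enat k" "norm (grad f (x k)) \<le> M"
proof -
  let ?S = "{enat k | k. norm (grad f (x k)) \<le> M}"
  have ne: "?S \<noteq> {}"
  proof
    assume "?S = {}"
    then have "Inf ?S = \<infinity>" by (simp only: Inf_enat_def simp_thms if_True)
    then show False using assms by (simp add: iters_to_grad_def)
  qed
  then have "Inf ?S = (LEAST m. m \<in> ?S)" by (simp only: Inf_enat_def if_False)
  moreover have "(LEAST m. m \<in> ?S) \<in> ?S" using ne by (meson LeastI ex_in_conv)
  ultimately have "Inf ?S \<in> ?S" by simp
  then show ?thesis using that by (auto simp: iters_to_grad_def)
qed

theorem theorem8p1:
  fixes f :: "real ^ 'n \<Rightarrow> ereal" and l :: "real \<Rightarrow> real"
    and x\<^sub>0 xstar :: "real ^ 'n" and x :: "nat \<Rightarrow> real ^ 'n"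
    and \<epsilon> :: real and T :: nat
  assumes "ell_smooth l f"
    and "convex_ereal f"
    and "\<forall>y. f xstar \<le> f y"
    and "x\<^sub>0 \<in> eff_dom f"
    and "x 0 = x\<^sub>0"
    and "\<forall>k. x (Suc k) = x k - step_size l f (x k) *\<^sub>R grad f (x k)"
    and "\<epsilon> > 0"
    and "ereal (real T) \<ge> (INF M\<in>{0<..}. ereal_of_enat (iters_to_grad f x M)
           + ereal (l (2 * M) * (norm (x\<^sub>0 - xstar))\<^sup>2 / (2 * \<epsilon>)))"
  shows "f (x T) - f xstar \<le> ereal \<epsilon>"
proof -
  let ?X = "eff_dom f"
  define F where "F = (\<lambda>y. real_of_ereal (f y))"
  interpret convex_generalized_smooth ?X F "grad f" "\<lambda>y. frechet_derivative (grad f) (at y)" l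
    unfolding F_def by (rule ell_smooth_convex_generalized_smooth[OF assms(1,2)])
  have fin: "f y = ereal (F y)" if "y \<in> ?X" for y
    using assms(1) that by (cases "f y") (auto simp: F_def ell_smooth_def eff_dom_def)
  have x0: "x 0 \<in> ?X" using assms(4,5) by simp
  have star: "xstar \<in> ?X"
    using assms(3,4) by (auto simp: eff_dom_def intro: le_less_trans)
  have min: "F xstar \<le> F y" if "y \<in> ?X" for y
    using assms(3) fin[OF star] fin[OF that] by (metis ereal_less_eq(3))
  have iter: "x (Suc k) = gd_step (x k)" for k
    using assms(6) by (simp add: gd_step_def step_length_def step_size_def)
  note in_X = iterate_in_domain[of x xstar, OF x0 iter star min]
  note dist = iterate_distance_antimono[of x xstar, OF x0 iter star min]
  note rate = suboptimality_after_small_gradient[of x xstar, OF x0 iter star min]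
  define R where "R = (norm (x 0 - xstar))\<^sup>2"
  have "F (x T) - F xstar \<le> \<epsilon>"
  proof (cases "R = 0")
    case True
    then have "(norm (x T - xstar))\<^sup>2 \<le> 0" using dist[of T] by (simp add: R_def)
    then show ?thesis using assms(7) by simp
  next
    case False
    then have R: "R > 0" by (simp add: R_def)
    define c where "c = l 0 * R / (2 * \<epsilon>)"
    have c: "c > 0" using R l_pos[of 0] assms(7) by (simp add: c_def)
    \<comment> \<open>The infimum over \<open>M\<close> need not be attained, so the budget is only met up to \<open>\<delta>\<close>. Taking
      \<open>\<delta> \<le> c\<close> makes the gradient small strictly before iteration \<open>T\<close>.\<close>
    have approx: "F (x T) - F xstar \<le> \<epsilon> * (1 + \<delta>)" if \<delta>: "0 < \<delta>" "\<delta> \<le> c" for \<delta>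
    proof -
      have "ereal (real T) < ereal (real T + \<delta>)" using \<delta> by simp
      with assms(8) have "(INF M\<in>{0<..}. ereal_of_enat (iters_to_grad f x M)
           + ereal (l (2 * M) * R / (2 * \<epsilon>))) < ereal (real T + \<delta>)"
        unfolding R_def assms(5) by (rule le_less_trans)
      then obtain M where M: "M > 0" "ereal_of_enat (iters_to_grad f x M)
           + ereal (l (2 * M) * R / (2 * \<epsilon>)) < ereal (real T + \<delta>)"
        unfolding INF_less_iff by auto
      have "iters_to_grad f x M \<noteq> \<infinity>"
      proof
        assume "iters_to_grad f x M = \<infinity>"
        then show False using M(2) by simp
      qed
      then obtain k where k: "iters_to_grad f x M = enat k" "norm (grad f (x k)) \<le> M"
        by (rule iters_to_grad_attained)
      have budget: "real k + l (2 * M) * R / (2 * \<epsilon>) < real T + \<delta>"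
        using M(2) by (simp add: k(1))
      have "c \<le> l (2 * M) * R / (2 * \<epsilon>)"
        unfolding c_def using R assms(7) M(1)
        by (intro divide_right_mono mult_right_mono mono_onD[OF l_mono]) auto
      then have kT: "k < T" using budget \<delta> by linarith
      define j where "j = T - k"
      have j: "T = k + j" "j \<ge> 1" using kT by (auto simp: j_def)
      have "2 * real j * (F (x T) - F xstar) \<le> l (2 * M) * R"
        using rate[OF _ k(2), of j] by (simp add: R_def j(1))
      also have "\<dots> = 2 * \<epsilon> * (l (2 * M) * R / (2 * \<epsilon>))" using assms(7) by simp
      also have "\<dots> \<le> 2 * \<epsilon> * (real j + \<delta>)"
        using budget assms(7) by (intro mult_left_mono) (auto simp: j(1))
      also have "\<dots> \<le> 2 * \<epsilon> * (real j * (1 + \<delta>))"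
        using assms(7) j(2) \<delta> by (intro mult_left_mono) (auto simp: algebra_simps)
      finally have "real j * (F (x T) - F xstar) \<le> real j * (\<epsilon> * (1 + \<delta>))"
        by (simp add: algebra_simps)
      then show ?thesis using j(2) by simp
    qed
    show ?thesis
    proof (rule field_le_epsilon)
      fix e :: real assume e: "e > 0"
      define \<delta> where "\<delta> = min c (e / \<epsilon>)"
      have "F (x T) - F xstar \<le> \<epsilon> * (1 + \<delta>)"
        using c e assms(7) by (intro approx) (auto simp: \<delta>_def)
      also have "\<dots> \<le> \<epsilon> * (1 + e / \<epsilon>)"
        using assms(7) by (intro mult_left_mono) (auto simp: \<delta>_def)
      also have "\<dots> = \<epsilon> + e" using assms(7) by (simp add: field_simps)
      finally show "F (x T) - F xstar \<le> \<epsilon> + e" .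
    qed
  qed
  then show ?thesis by (simp add: fin[OF in_X] fin[OF star])
qed

end
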